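(* Let $M$ be a matroid on a finite ground set and let $\mathbb H_1$ be a sub-hyperfield of a hyperfield $\mathbb H_2$. Then there exist injections $$i:\mathcal M^w_{\mathbb H_1}(M)\hookrightarrow\mathcal M^w_{\mathbb H_2}(M),\qquad j:\mathcal R^w_{\mathbb H_1}(M)\hookrightarrow\mathcal R^w_{\mathbb H_2}(M),$$ which are continuous when $\mathbb H_1,\mathbb H_2$ are topological hyperfields and the inclusion $\mathbb H_1\hookrightarrow\mathbb H_2$ is continuous. The same holds in the strong case (superscript $s$ in place of $w$).
   Context: A hyperfield is $(\mathbb H,\boxplus,\odot,0,1)$ with $0\ne1$ where: $\boxplus$ is a commutative, associative hyperoperation (each $a\boxplus b$ is a nonempty subset of $\mathbb H$; for subsets, $A\boxplus B=\bigcup_{a\in A,b\in B}a\boxplus b$) with $0\boxplus x=\{x\}$, each $x$ has a unique $-x$ with $0\in x\boxplus -x$, and $x\in y\boxplus z\iff z\in x\boxplus -y$; $(\mathbb H,\odot,1)$ is a commutative monoid, $0\odot x=0$, $a\odot(x\boxplus y)=(a\odot x)\boxplus(a\odot y)$; and $\mathbb H^*=\mathbb H\setminus\{0\}$ is a group under $\odot$. A sub-hyperfield of $\mathbb H_2$ is a subset $\mathbb H_1\subseteq\mathbb H_2$ that is itself a hyperfield with respect to the operations induced by $\mathbb H_2$. A topological hyperfield carries a topology with $\mathbb H^*$ open, $\odot$ continuous on $\mathbb H\times\mathbb H$, and inversion continuous on $\mathbb H^*$. Let $d$ be the rank and $E$ the ground set of $M$. A strong Grassmann–Plücker function of rank $d$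 with values in $\mathbb H$ is a nonzero alternating $\varphi:E^d\to\mathbb H$ with $0\in\boxplus_{k=1}^{d+1}(-1)^k\odot\varphi(x_1,\dots,\hat x_k,\dots,x_{d+1})\odot\varphi(x_k,y_1,\dots,y_{d-1})$ for all subsets $I=\{x_1,\dots,x_{d+1}\}$, $J=\{y_1,\dots,y_{d-1}\}$ of $E$; a weak one is a nonzero alternating function whose support is the set of bases of a matroid and for which this holds whenever $|I\setminus J|\le3$. Its underlying matroid is the one whose bases form the support of $\varphi$. $\mathcal M^w_{\mathbb H}(M)$ (resp. $\mathcal M^s_{\mathbb H}(M)$), the space of weak (resp. strong) $\mathbb H$-matroids with underlying matroid $M$, is the set of weak (resp. strong) Grassmann–Plücker functions with underlying matroid $M$ (topologized as a subset of $\mathbb H^{E^d}$) modulo $\varphi\sim a\odot\varphi$, $a\in\mathbb H^*$. $\mathcal R^w_{\mathbb H}(M)$ (resp. $\mathcal R^s_{\mathbb H}(M)$), the space of rescaling classes, is the quotient of $\mathcal M^w_{\mathbb H}(M)$ (resp. $\mathcal M^s_{\mathbb H}(M)$) by the relation identifying the class of $\varphi$ with that of $(x_1,\dots,x_d)\mapsto\left(\bigodot_{l=1}^dh(x_l)\right)\odot\varphi(x_1,\dots,x_d)$ for every $h:E\to\mathbb H^*$. Quotients carry the quotient topology. *)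

theory Defs
  imports "HOL-Analysis.Analysis" "HOL-Algebra.FiniteProduct"
begin

section \<open>Hyperfields\<close>

record 'a hyperfield = "'a monoid" +
  hzero :: 'a (\<open>\<zero>\<index>\<close>)
  hadd :: "['a, 'a] \<Rightarrow> 'a set" (infixl \<open>\<boxplus>\<index>\<close> 65)

definition hadd_set :: "('a, 'm) hyperfield_scheme \<Rightarrow> 'a set \<Rightarrow> 'a set \<Rightarrow> 'a set" where
  "hadd_set H A B = (\<Union>a\<in>A. \<Union>b\<in>B. a \<boxplus>\<^bsub>H\<^esub> b)"

definition hneg :: "('a, 'm) hyperfield_scheme \<Rightarrow> 'a \<Rightarrow> 'a" where
  "hneg H x = (THE y. y \<in> carrier H \<and> \<zero>\<^bsub>H\<^esub> \<in> x \<boxplus>\<^bsub>H\<^esub> y)"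

definition hnonzero :: "('a, 'm) hyperfield_scheme \<Rightarrow> 'a set" where
  "hnonzero H = carrier H - {\<zero>\<^bsub>H\<^esub>}"

locale hyperfield = comm_monoid H for H (structure) +
  assumes zero_closed: "\<zero> \<in> carrier H"
    and zero_neq_one: "\<zero> \<noteq> \<one>"
    and hadd_closed: "\<lbrakk>x \<in> carrier H; y \<in> carrier H\<rbrakk> \<Longrightarrow> x \<boxplus> y \<subseteq> carrier H"
    and hadd_nonempty: "\<lbrakk>x \<in> carrier H; y \<in> carrier H\<rbrakk> \<Longrightarrow> x \<boxplus> y \<noteq> {}"
    and hadd_comm: "\<lbrakk>x \<in> carrier H; y \<in> carrier H\<rbrakk> \<Longrightarrow> x \<boxplus> y = y \<boxplus> x"
    and hadd_assoc: "\<lbrakk>x \<in> carrier H; y \<in> carrier H; z \<in> carrier H\<rbrakk> \<Longrightarrow>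
      hadd_set H (x \<boxplus> y) {z} = hadd_set H {x} (y \<boxplus> z)"
    and hadd_zero: "x \<in> carrier H \<Longrightarrow> \<zero> \<boxplus> x = {x}"
    and hneg_ex1: "x \<in> carrier H \<Longrightarrow> \<exists>!y. y \<in> carrier H \<and> \<zero> \<in> x \<boxplus> y"
    and reversible: "\<lbrakk>x \<in> carrier H; y \<in> carrier H; z \<in> carrier H\<rbrakk> \<Longrightarrow>
      x \<in> y \<boxplus> z \<longleftrightarrow> z \<in> x \<boxplus> hneg H y"
    and zero_mult: "x \<in> carrier H \<Longrightarrow> \<zero> \<otimes> x = \<zero>"
    and distrib: "\<lbrakk>a \<in> carrier H; x \<in> carrier H; y \<in> carrier H\<rbrakk> \<Longrightarrow>
      (\<lambda>t. a \<otimes> t) ` (x \<boxplus> y) = (a \<otimes> x) \<boxplus> (a \<otimes> y)"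
    and nonzero_group: "group (H\<lparr>carrier := hnonzero H\<rparr>)"

text \<open>
  The structure that \<open>H\<close> induces on a subset \<open>S\<close>. The induced hypersum of two elements is the
  part of their hypersum in \<open>H\<close> that lies in \<open>S\<close>; \<open>S\<close> need not contain the whole hypersum.
\<close>

definition hinduced :: "('a, 'm) hyperfield_scheme \<Rightarrow> 'a set \<Rightarrow> ('a, 'm) hyperfield_scheme" where
  "hinduced H S = H\<lparr>carrier := S, hadd := (\<lambda>x y. (x \<boxplus>\<^bsub>H\<^esub> y) \<inter> S)\<rparr>"

definition sub_hyperfield :: "'a set \<Rightarrow> ('a, 'm) hyperfield_scheme \<Rightarrow> bool" where
  "sub_hyperfield S H \<longleftrightarrow> S \<subseteq> carrier H \<and> hyperfield (hinduced H S)"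

text \<open>Continuity of hyperaddition is not part of the definition.\<close>

definition topological_hyperfield :: "('a, 'm) hyperfield_scheme \<Rightarrow> 'a topology \<Rightarrow> bool" where
  "topological_hyperfield H T \<longleftrightarrow>
     hyperfield H \<and> topspace T = carrier H \<and>
     openin T (hnonzero H) \<and>
     continuous_map (prod_topology T T) T (\<lambda>(x, y). x \<otimes>\<^bsub>H\<^esub> y) \<and>
     continuous_map (subtopology T (hnonzero H)) (subtopology T (hnonzero H)) (\<lambda>x. inv\<^bsub>H\<^esub> x)"

fun hsum :: "('a, 'm) hyperfield_scheme \<Rightarrow> 'a list \<Rightarrow> 'a set" where
  "hsum H [] = {\<zero>\<^bsub>H\<^esub>}"
| "hsum H (a # as) = hadd_set H {a} (hsum H as)"


section \<open>Matroids\<close>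

locale matroid =
  fixes E :: "'e set" and \<B> :: "'e set set"
  assumes finite_ground: "finite E"
    and bases_subset: "\<B> \<subseteq> Pow E"
    and bases_nonempty: "\<B> \<noteq> {}"
    and exchange: "\<lbrakk>A \<in> \<B>; B \<in> \<B>; a \<in> A - B\<rbrakk> \<Longrightarrow> \<exists>b\<in>B - A. insert b (A - {a}) \<in> \<B>"

text \<open>All bases of a matroid have the same cardinality.\<close>

definition matroid_rank :: "'e set set \<Rightarrow> nat" where
  "matroid_rank \<B> = Max (card ` \<B>)"


section \<open>Grassmann--Pluecker functions\<close>

definition tuples :: "'e set \<Rightarrow> nat \<Rightarrow> 'e list set" where
  "tuples E d = {xs. set xs \<subseteq> E \<and> length xs = d}"

definition alternating ::
  "('a, 'm) hyperfield_scheme \<Rightarrow> 'e set \<Rightarrow> nat \<Rightarrow> ('e list \<Rightarrow> 'a) \<Rightarrow> bool" where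
  "alternating H E d \<phi> \<longleftrightarrow>
     (\<forall>xs\<in>tuples E d.
        (\<forall>i j. i < j \<and> j < d \<longrightarrow> \<phi> (xs[i := xs ! j, j := xs ! i]) = hneg H (\<phi> xs)) \<and>
        (\<not> distinct xs \<longrightarrow> \<phi> xs = \<zero>\<^bsub>H\<^esub>))"

definition nonzero_alternating ::
  "('a, 'm) hyperfield_scheme \<Rightarrow> 'e set \<Rightarrow> nat \<Rightarrow> ('e list \<Rightarrow> 'a) \<Rightarrow> bool" where
  "nonzero_alternating H E d \<phi> \<longleftrightarrow>
     \<phi> \<in> tuples E d \<rightarrow>\<^sub>E carrier H \<and>
     (\<exists>xs\<in>tuples E d. \<phi> xs \<noteq> \<zero>\<^bsub>H\<^esub>) \<and>
     alternating H E d \<phi>"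

text \<open>
  The list \<open>xs\<close> enumerates \<open>I = {x\<^sub>1, \<dots>, x\<^sub>d\<^sub>+\<^sub>1}\<close> and \<open>ys\<close> enumerates \<open>J\<close>. List positions start
  at \<open>0\<close>, so the sign of the term in which \<open>xs ! k\<close> is moved has exponent \<open>Suc k\<close>.
\<close>

definition gp_relation ::
  "('a, 'm) hyperfield_scheme \<Rightarrow> ('e list \<Rightarrow> 'a) \<Rightarrow> 'e list \<Rightarrow> 'e list \<Rightarrow> bool" where
  "gp_relation H \<phi> xs ys \<longleftrightarrow>
     \<zero>\<^bsub>H\<^esub> \<in> hsum H
       (map (\<lambda>k. (hneg H \<one>\<^bsub>H\<^esub> [^]\<^bsub>H\<^esub> Suc k) \<otimes>\<^bsub>H\<^esub> \<phi> (take k xs @ drop (Suc k) xs)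
                   \<otimes>\<^bsub>H\<^esub> \<phi> (xs ! k # ys))
            [0..<length xs])"

definition gp_bases ::
  "('a, 'm) hyperfield_scheme \<Rightarrow> 'e set \<Rightarrow> nat \<Rightarrow> ('e list \<Rightarrow> 'a) \<Rightarrow> 'e set set" where
  "gp_bases H E d \<phi> = set ` {xs \<in> tuples E d. \<phi> xs \<noteq> \<zero>\<^bsub>H\<^esub>}"

text \<open>
  The condition \<open>length ys + 1 = d\<close> rather than \<open>length ys = d - 1\<close> makes the Grassmann--Pluecker
  relations vacuous in rank \<open>0\<close>, where no set \<open>J\<close> of size \<open>-1\<close> exists.
\<close>

definition strong_gp ::
  "('a, 'm) hyperfield_scheme \<Rightarrow> 'e set \<Rightarrow> nat \<Rightarrow> ('e list \<Rightarrow> 'a) \<Rightarrow> bool" where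
  "strong_gp H E d \<phi> \<longleftrightarrow>
     nonzero_alternating H E d \<phi> \<and>
     (\<forall>xs ys. set xs \<subseteq> E \<and> distinct xs \<and> length xs = d + 1 \<and>
              set ys \<subseteq> E \<and> distinct ys \<and> length ys + 1 = d \<longrightarrow> gp_relation H \<phi> xs ys)"

definition weak_gp ::
  "('a, 'm) hyperfield_scheme \<Rightarrow> 'e set \<Rightarrow> nat \<Rightarrow> ('e list \<Rightarrow> 'a) \<Rightarrow> bool" where
  "weak_gp H E d \<phi> \<longleftrightarrow>
     nonzero_alternating H E d \<phi> \<and>
     matroid E (gp_bases H E d \<phi>) \<and>
     (\<forall>xs ys. set xs \<subseteq> E \<and> distinct xs \<and> length xs = d + 1 \<and>
              set ys \<subseteq> E \<and> distinct ys \<and> length ys + 1 = d \<and>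
              card (set xs - set ys) \<le> 3 \<longrightarrow> gp_relation H \<phi> xs ys)"

definition strong_gp_functions ::
  "('a, 'm) hyperfield_scheme \<Rightarrow> 'e set \<Rightarrow> 'e set set \<Rightarrow> ('e list \<Rightarrow> 'a) set" where
  "strong_gp_functions H E \<B> =
     {\<phi>. strong_gp H E (matroid_rank \<B>) \<phi> \<and> gp_bases H E (matroid_rank \<B>) \<phi> = \<B>}"

definition weak_gp_functions ::
  "('a, 'm) hyperfield_scheme \<Rightarrow> 'e set \<Rightarrow> 'e set set \<Rightarrow> ('e list \<Rightarrow> 'a) set" where
  "weak_gp_functions H E \<B> =
     {\<phi>. weak_gp H E (matroid_rank \<B>) \<phi> \<and> gp_bases H E (matroid_rank \<B>) \<phi> = \<B>}"


section \<open>Quotient topologies\<close>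

definition quotient_topology :: "'a topology \<Rightarrow> ('a \<times> 'a) set \<Rightarrow> 'a set topology" where
  "quotient_topology X r =
     topology (\<lambda>U. U \<subseteq> topspace X // r \<and> openin X {x \<in> topspace X. r `` {x} \<in> U})"

lemma openin_quotient_topology:
  "openin (quotient_topology X r) U \<longleftrightarrow>
     U \<subseteq> topspace X // r \<and> openin X {x \<in> topspace X. r `` {x} \<in> U}"
proof -
  let ?P = "\<lambda>U. U \<subseteq> topspace X // r \<and> openin X {x \<in> topspace X. r `` {x} \<in> U}"
  have "?P (S \<inter> T)" if "?P S" "?P T" for S T
  proof -
    have "{x \<in> topspace X. r `` {x} \<in> S \<inter> T} =
          {x \<in> topspace X. r `` {x} \<in> S} \<inter> {x \<in> topspace X. r `` {x} \<in> T}" by auto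
    then show ?thesis using that by auto
  qed
  moreover have "?P (\<Union>K)" if "\<forall>U\<in>K. ?P U" for K
  proof -
    have "{x \<in> topspace X. r `` {x} \<in> \<Union>K} = (\<Union>U\<in>K. {x \<in> topspace X. r `` {x} \<in> U})" by auto
    then show ?thesis using that by auto
  qed
  ultimately have "istopology ?P" unfolding istopology_def by blast
  then show ?thesis by (simp add: quotient_topology_def topology_inverse')
qed

lemma topspace_quotient_topology: "topspace (quotient_topology X r) = topspace X // r"
proof -
  have "{x \<in> topspace X. r `` {x} \<in> topspace X // r} = topspace X"
    by (auto intro: quotientI)
  then have "openin (quotient_topology X r) (topspace X // r)"
    by (simp add: openin_quotient_topology)
  then show ?thesis
    by (metis openin_quotient_topology openin_subset openin_topspace subset_antisym)
qed

lemma quotient_map_quotient_topology: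
  "quotient_map X (quotient_topology X r) (\<lambda>x. r `` {x})"
  unfolding quotient_map_def
  by (auto simp: openin_quotient_topology topspace_quotient_topology quotient_def)


section \<open>Spaces of matroids over a hyperfield and of rescaling classes\<close>

text \<open>
  In this section \<open>P\<close> is the set of weak, or of strong, Grassmann--Pluecker functions on \<open>d\<close>-tuples
  from \<open>E\<close> with a given underlying matroid.
\<close>

definition scale ::
  "('a, 'm) hyperfield_scheme \<Rightarrow> 'e set \<Rightarrow> nat \<Rightarrow> 'a \<Rightarrow> ('e list \<Rightarrow> 'a) \<Rightarrow> 'e list \<Rightarrow> 'a" where
  "scale H E d a \<phi> = (\<lambda>xs\<in>tuples E d. a \<otimes>\<^bsub>H\<^esub> \<phi> xs)"

definition rescale ::
  "('a, 'm) hyperfield_scheme \<Rightarrow> 'e set \<Rightarrow> nat \<Rightarrow> ('e \<Rightarrow> 'a) \<Rightarrow> ('e list \<Rightarrow> 'a) \<Rightarrow> 'e list \<Rightarrow> 'a" where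
  "rescale H E d h \<phi> = (\<lambda>xs\<in>tuples E d. (\<Otimes>\<^bsub>H\<^esub>l\<in>{..<d}. h (xs ! l)) \<otimes>\<^bsub>H\<^esub> \<phi> xs)"

definition scale_rel ::
  "('a, 'm) hyperfield_scheme \<Rightarrow> 'e set \<Rightarrow> nat \<Rightarrow> ('e list \<Rightarrow> 'a) set \<Rightarrow>
     (('e list \<Rightarrow> 'a) \<times> ('e list \<Rightarrow> 'a)) set" where
  "scale_rel H E d P = {(\<phi>, \<psi>) \<in> P \<times> P. \<exists>a\<in>hnonzero H. \<psi> = scale H E d a \<phi>}"

definition hmatroids ::
  "('a, 'm) hyperfield_scheme \<Rightarrow> 'e set \<Rightarrow> nat \<Rightarrow> ('e list \<Rightarrow> 'a) set \<Rightarrow>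
     ('e list \<Rightarrow> 'a) set set" where
  "hmatroids H E d P = P // scale_rel H E d P"

definition rescale_rel ::
  "('a, 'm) hyperfield_scheme \<Rightarrow> 'e set \<Rightarrow> nat \<Rightarrow> ('e list \<Rightarrow> 'a) set \<Rightarrow>
     (('e list \<Rightarrow> 'a) set \<times> ('e list \<Rightarrow> 'a) set) set" where
  "rescale_rel H E d P =
     {(A, B) \<in> hmatroids H E d P \<times> hmatroids H E d P.
        \<exists>\<phi>\<in>A. \<exists>h\<in>E \<rightarrow> hnonzero H. rescale H E d h \<phi> \<in> B}"

definition rescaling_classes ::
  "('a, 'm) hyperfield_scheme \<Rightarrow> 'e set \<Rightarrow> nat \<Rightarrow> ('e list \<Rightarrow> 'a) set \<Rightarrow>
     ('e list \<Rightarrow> 'a) set set set" where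
  "rescaling_classes H E d P = hmatroids H E d P // rescale_rel H E d P"

definition hmatroids_topology ::
  "('a, 'm) hyperfield_scheme \<Rightarrow> 'a topology \<Rightarrow> 'e set \<Rightarrow> nat \<Rightarrow> ('e list \<Rightarrow> 'a) set \<Rightarrow>
     ('e list \<Rightarrow> 'a) set topology" where
  "hmatroids_topology H T E d P =
     quotient_topology (subtopology (product_topology (\<lambda>_. T) (tuples E d)) P)
       (scale_rel H E d P)"

definition rescaling_classes_topology ::
  "('a, 'm) hyperfield_scheme \<Rightarrow> 'a topology \<Rightarrow> 'e set \<Rightarrow> nat \<Rightarrow> ('e list \<Rightarrow> 'a) set \<Rightarrow>
     ('e list \<Rightarrow> 'a) set set topology" where
  "rescaling_classes_topology H T E d P =
     quotient_topology (hmatroids_topology H T E d P) (rescale_rel H E d P)"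

definition weak_matroids ::
  "('a, 'm) hyperfield_scheme \<Rightarrow> 'e set \<Rightarrow> 'e set set \<Rightarrow> ('e list \<Rightarrow> 'a) set set" where
  "weak_matroids H E \<B> = hmatroids H E (matroid_rank \<B>) (weak_gp_functions H E \<B>)"

definition strong_matroids ::
  "('a, 'm) hyperfield_scheme \<Rightarrow> 'e set \<Rightarrow> 'e set set \<Rightarrow> ('e list \<Rightarrow> 'a) set set" where
  "strong_matroids H E \<B> = hmatroids H E (matroid_rank \<B>) (strong_gp_functions H E \<B>)"

definition weak_rescaling_classes ::
  "('a, 'm) hyperfield_scheme \<Rightarrow> 'e set \<Rightarrow> 'e set set \<Rightarrow> ('e list \<Rightarrow> 'a) set set set" where
  "weak_rescaling_classes H E \<B> =
     rescaling_classes H E (matroid_rank \<B>) (weak_gp_functions H E \<B>)"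

definition strong_rescaling_classes ::
  "('a, 'm) hyperfield_scheme \<Rightarrow> 'e set \<Rightarrow> 'e set set \<Rightarrow> ('e list \<Rightarrow> 'a) set set set" where
  "strong_rescaling_classes H E \<B> =
     rescaling_classes H E (matroid_rank \<B>) (strong_gp_functions H E \<B>)"

definition weak_matroids_topology ::
  "('a, 'm) hyperfield_scheme \<Rightarrow> 'a topology \<Rightarrow> 'e set \<Rightarrow> 'e set set \<Rightarrow>
     ('e list \<Rightarrow> 'a) set topology" where
  "weak_matroids_topology H T E \<B> =
     hmatroids_topology H T E (matroid_rank \<B>) (weak_gp_functions H E \<B>)"

definition strong_matroids_topology ::
  "('a, 'm) hyperfield_scheme \<Rightarrow> 'a topology \<Rightarrow> 'e set \<Rightarrow> 'e set set \<Rightarrow>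
     ('e list \<Rightarrow> 'a) set topology" where
  "strong_matroids_topology H T E \<B> =
     hmatroids_topology H T E (matroid_rank \<B>) (strong_gp_functions H E \<B>)"

definition weak_rescaling_classes_topology ::
  "('a, 'm) hyperfield_scheme \<Rightarrow> 'a topology \<Rightarrow> 'e set \<Rightarrow> 'e set set \<Rightarrow>
     ('e list \<Rightarrow> 'a) set set topology" where
  "weak_rescaling_classes_topology H T E \<B> =
     rescaling_classes_topology H T E (matroid_rank \<B>) (weak_gp_functions H E \<B>)"

definition strong_rescaling_classes_topology ::
  "('a, 'm) hyperfield_scheme \<Rightarrow> 'a topology \<Rightarrow> 'e set \<Rightarrow> 'e set set \<Rightarrow>
     ('e list \<Rightarrow> 'a) set set topology" where
  "strong_rescaling_classes_topology H T E \<B> =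
     rescaling_classes_topology H T E (matroid_rank \<B>) (strong_gp_functions H E \<B>)"

end

theory Submission
  imports Defs
begin

text \<open>
  A Grassmann--Pluecker function over the sub-hyperfield is one over the big hyperfield, so both maps
  come from the inclusion, and only injectivity on rescaling classes is not formal. Suppose
  \<open>\<psi> = a \<cdot> h \<cdot> \<phi>\<close> with \<open>a\<close>, \<open>h\<close> over the big hyperfield and \<open>\<phi>\<close>, \<open>\<psi>\<close> over the small one. Then
  \<open>a \<Prod>\<^bsub>e \<in> B\<^esub> h(e)\<close> is a small unit for every basis \<open>B\<close>, so \<open>h(e)\<close> and \<open>h(f)\<close> lie in the same coset
  of the small units whenever \<open>e\<close> can be exchanged for \<open>f\<close> in some basis. Write \<open>h(e) = h'(e) k(e)\<close>,
  where \<open>k(e)\<close> is a chosen representative of the coset of \<open>h(e)\<close>. As bases are connected through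
  exchanges, \<open>\<Prod>\<^bsub>e \<in> B\<^esub> k(e)\<close> does not depend on \<open>B\<close> and can be absorbed into \<open>a\<close>.
\<close>

section \<open>Maps between quotients\<close>

text \<open>Saturating the image of the whole class makes a choice of representative unnecessary.
  For compatible relations the result is a single class of \<open>s\<close>.\<close>

definition quotient_lift :: "('b \<times> 'b) set \<Rightarrow> ('a \<Rightarrow> 'b) \<Rightarrow> 'a set \<Rightarrow> 'b set" where
  "quotient_lift s f A = s `` (f ` A)"

text \<open>Of the two directions of \<open>rel_iff\<close>, the forward one makes the induced map
  on classes well defined and the backward one makes it injective. The locale serves twice: for the
  inclusion of functions modulo scaling, and then for the resulting map on classes modulo
  rescaling.\<close>

locale relation_embedding =
  fixes X :: "'a set" and r and Y :: "'b set" and s and f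
  assumes equiv_dom: "equiv X r"
    and equiv_cod: "equiv Y s"
    and maps_to: "f \<in> X \<rightarrow> Y"
    and rel_iff: "\<lbrakk>x \<in> X; y \<in> X\<rbrakk> \<Longrightarrow> (x, y) \<in> r \<longleftrightarrow> (f x, f y) \<in> s"
begin

lemma quotient_lift_class:
  assumes "x \<in> X"
  shows "quotient_lift s f (r `` {x}) = s `` {f x}"
proof -
  have "s `` {f y} = s `` {f x}" if "(x, y) \<in> r" for y
  proof -
    have "y \<in> X" using equiv_dom that by (auto simp: equiv_def refl_on_def)
    then have "(f x, f y) \<in> s" using rel_iff[of x y] that assms by blast
    then show ?thesis using equiv_class_eq[OF equiv_cod] by blast
  qed
  moreover have "(x, x) \<in> r" using equiv_dom assms by (auto simp: equiv_def refl_on_def)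
  ultimately show ?thesis unfolding quotient_lift_def by blast
qed

lemma quotient_lift_maps_to: "quotient_lift s f \<in> X // r \<rightarrow> Y // s"
proof
  fix A assume "A \<in> X // r"
  then obtain x where "x \<in> X" "A = r `` {x}" by (rule quotientE)
  then show "quotient_lift s f A \<in> Y // s"
    using maps_to by (auto simp: quotient_lift_class intro: quotientI)
qed

lemma inj_on_quotient_lift: "inj_on (quotient_lift s f) (X // r)"
proof (rule inj_onI)
  fix A B assume "A \<in> X // r" "B \<in> X // r" and eq: "quotient_lift s f A = quotient_lift s f B"
  then obtain x y where x: "x \<in> X" "A = r `` {x}" and y: "y \<in> X" "B = r `` {y}"
    by (metis quotientE)
  have "s `` {f x} = s `` {f y}" using eq x y by (simp add: quotient_lift_class)
  then have "(f x, f y) \<in> s" using eq_equiv_class[OF _ equiv_cod] maps_to y(1) by blast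
  then show "A = B" using x y rel_iff equiv_class_eq[OF equiv_dom] by blast
qed

lemma continuous_map_quotient_lift:
  assumes "topspace TX = X" and f: "continuous_map TX TY f"
  shows "continuous_map (quotient_topology TX r) (quotient_topology TY s) (quotient_lift s f)"
proof -
  have "continuous_map TX (quotient_topology TY s) ((\<lambda>y. s `` {y}) \<circ> f)"
    using f quotient_imp_continuous_map[OF quotient_map_quotient_topology]
    by (rule continuous_map_compose)
  then have "continuous_map TX (quotient_topology TY s) (quotient_lift s f \<circ> (\<lambda>x. r `` {x}))"
    by (rule continuous_map_eq) (simp add: assms(1) quotient_lift_class)
  then show ?thesis
    by (rule continuous_compose_quotient_map[OF quotient_map_quotient_topology])
qed

end


section \<open>Products over the bases of a matroid\<close>

lemma (in matroid) finite_basis: "B \<in> \<B> \<Longrightarrow> finite B"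
  using bases_subset finite_ground finite_subset by blast

text \<open>A basis exchange moves \<open>A\<close> one element closer to \<open>B\<close> and
  replaces one factor by an equal one, so the product is unchanged. Repeating this until
  \<open>A - B\<close> is empty reaches \<open>B\<close>.\<close>

lemma (in matroid) finprod_bases_eq:
  fixes G (structure)
  assumes "comm_monoid G" and k: "k \<in> E \<rightarrow> carrier G"
    and exchange_eq: "\<And>B e f. \<lbrakk>B \<in> \<B>; insert f (B - {e}) \<in> \<B>; e \<in> B; f \<in> E - B\<rbrakk> \<Longrightarrow> k e = k f"
    and "A \<in> \<B>" "B \<in> \<B>"
  shows "finprod G k A = finprod G k B"
  using \<open>A \<in> \<B>\<close>
proof (induction "card (A - B)" arbitrary: A)
  interpret G: comm_monoid G by fact
  case 0
  then have "A \<subseteq> B" using finite_basis by simp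
  \<comment> \<open>An element of \<open>B - A\<close> would have to be exchanged for an element of
    \<open>A - B\<close>, which is empty.\<close>
  moreover have "B \<subseteq> A" using exchange[OF \<open>B \<in> \<B>\<close> 0(2)] \<open>A \<subseteq> B\<close> by blast
  ultimately show ?case by simp
next
  interpret G: comm_monoid G by fact
  case (Suc n)
  then obtain a where a: "a \<in> A - B"
    by (metis card.empty equals0I nat.distinct(1))
  obtain b where b: "b \<in> B - A" and A': "insert b (A - {a}) \<in> \<B>"
    using exchange[OF Suc.prems \<open>B \<in> \<B>\<close> a] by blast
  have fin: "finite A" and sub: "A \<subseteq> E" "B \<subseteq> E"
    using Suc.prems \<open>B \<in> \<B>\<close> bases_subset finite_basis by auto
  have "insert b (A - {a}) - B = (A - B) - {a}" using b by blast
  then have "n = card (insert b (A - {a}) - B)" using Suc.hyps(2) a fin by simp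
  then have IH: "finprod G k (insert b (A - {a})) = finprod G k B" using Suc.hyps(1) A' by blast
  have "k a = k b" using exchange_eq[OF Suc.prems A'] a b sub by blast
  \<comment> \<open>Stated for a general \<open>c\<close> so that \<open>A\<close> and the exchanged
    basis are both split over the same remainder \<open>A - {a}\<close>.\<close>
  moreover have "finprod G k (insert c (A - {a})) = k c \<otimes> finprod G k (A - {a})"
    if "c \<in> E" "c \<notin> A - {a}" for c
    using that fin sub k by (intro G.finprod_insert) auto
  moreover have "a \<in> E" "b \<in> E" "b \<notin> A - {a}" using a b sub by auto
  ultimately have "finprod G k (insert a (A - {a})) = finprod G k (insert b (A - {a}))"
    by (metis DiffD2 singletonI)
  moreover have "insert a (A - {a}) = A" using a by blast
  ultimately show ?case using IH by simp
qed


section \<open>Hyperfields and scaling\<close>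

context hyperfield
begin

declare Units_closed [simp]

lemma nonzero_alternating_maps:
  "nonzero_alternating H E d \<phi> \<Longrightarrow> \<phi> \<in> tuples E d \<rightarrow>\<^sub>E carrier H"
  by (simp add: nonzero_alternating_def)

lemma mult_zero: "x \<in> carrier H \<Longrightarrow> x \<otimes> \<zero> = \<zero>"
  using zero_mult m_comm zero_closed by metis

text \<open>This brings the theory of units in a commutative monoid to bear on
  \<open>hnonzero\<close>. Nonzero elements are invertible by the group axiom, and zero is not a
  unit because it absorbs products and differs from one.\<close>

lemma hnonzero_eq_Units: "hnonzero H = Units H"
proof
  interpret N: group "H\<lparr>carrier := hnonzero H\<rparr>" by (rule nonzero_group)
  show "hnonzero H \<subseteq> Units H"
  proof
    fix x assume x: "x \<in> hnonzero H"
    then obtain y where "y \<in> hnonzero H" "y \<otimes> x = \<one>" using N.l_inv_ex by auto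
    moreover have "x \<otimes> y = y \<otimes> x" using x \<open>y \<in> hnonzero H\<close> by (simp add: hnonzero_def m_comm)
    ultimately show "x \<in> Units H" using x unfolding Units_def hnonzero_def by auto
  qed
  show "Units H \<subseteq> hnonzero H"
    using zero_mult zero_neq_one mult_zero unfolding Units_def hnonzero_def by auto
qed

lemma hneg_props:
  assumes "x \<in> carrier H"
  shows hneg_closed: "hneg H x \<in> carrier H" and zero_in_hadd_hneg: "\<zero> \<in> x \<boxplus> hneg H x"
  using theI'[OF hneg_ex1[OF assms]] unfolding hneg_def by auto

lemma hneg_unique: "\<lbrakk>x \<in> carrier H; y \<in> carrier H; \<zero> \<in> x \<boxplus> y\<rbrakk> \<Longrightarrow> hneg H x = y"
  using hneg_ex1 hneg_props by blast

text \<open>Multiplying \<open>\<zero> \<in> x \<boxplus> hneg H x\<close> by \<open>a\<close> and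
  distributing exhibits \<open>a \<otimes> hneg H x\<close> as a negative of
  \<open>a \<otimes> x\<close>, and negatives are unique.\<close>

lemma hneg_mult:
  assumes "a \<in> carrier H" "x \<in> carrier H"
  shows "hneg H (a \<otimes> x) = a \<otimes> hneg H x"
proof (rule hneg_unique)
  have "a \<otimes> \<zero> \<in> (\<lambda>t. a \<otimes> t) ` (x \<boxplus> hneg H x)" using zero_in_hadd_hneg assms by blast
  then show "\<zero> \<in> a \<otimes> x \<boxplus> a \<otimes> hneg H x" using distrib assms hneg_closed mult_zero by simp
qed (use assms hneg_closed in auto)

lemma hsum_closed: "set ts \<subseteq> carrier H \<Longrightarrow> hsum H ts \<subseteq> carrier H"
  by (induction ts) (use zero_closed hadd_closed in \<open>force simp: hadd_set_def\<close>)+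

text \<open>Distributivity is an equality of sets, not just an inclusion, so it passes through
  iterated hypersums by induction. It serves to pull a common factor out of a Grassmann--Pluecker
  sum.\<close>

lemma hsum_mult:
  assumes "c \<in> carrier H" "set ts \<subseteq> carrier H"
  shows "hsum H (map ((\<otimes>) c) ts) = (\<otimes>) c ` hsum H ts"
  using assms(2)
proof (induction ts)
  case Nil
  then show ?case using assms mult_zero by simp
next
  case (Cons x ts)
  have "(\<otimes>) c ` (x \<boxplus> t) = (c \<otimes> x) \<boxplus> (c \<otimes> t)" if "t \<in> hsum H ts" for t
    using that Cons.prems hsum_closed[of ts] assms(1) by (intro distrib) auto
  then have "(\<Union>t\<in>hsum H ts. (c \<otimes> x) \<boxplus> (c \<otimes> t)) = (\<otimes>) c ` (\<Union>t\<in>hsum H ts. x \<boxplus> t)"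
    by (simp add: image_UN)
  then show ?case using Cons by (simp add: hadd_set_def)
qed

lemma finprod_Units:
  assumes "f \<in> A \<rightarrow> Units H"
  shows "finprod H f A \<in> Units H"
  using assms
proof (induction A rule: infinite_finite_induct)
  case (insert x A)
  then have "f \<in> A \<rightarrow> carrier H" "f x \<in> Units H" "finprod H f A \<in> Units H" by auto
  then show ?case using insert.hyps by simp
qed auto

lemma finprod_nth_closed:
  assumes "h \<in> E \<rightarrow> Units H" "xs \<in> tuples E d"
  shows "(\<Otimes>l\<in>{..<d}. h (xs ! l)) \<in> Units H"
  using assms by (intro finprod_Units) (force simp: tuples_def Pi_iff)

section \<open>Scaling and rescaling as commuting actions, and their equivalence relations\<close>

lemma scale_closed:
  "\<lbrakk>a \<in> carrier H; \<phi> \<in> tuples E d \<rightarrow>\<^sub>E carrier H\<rbrakk> \<Longrightarrow> scale H E d a \<phi> \<in> tuples E d \<rightarrow>\<^sub>E carrier H"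
  unfolding scale_def by auto

lemma rescale_closed:
  "\<lbrakk>h \<in> E \<rightarrow> Units H; \<phi> \<in> tuples E d \<rightarrow>\<^sub>E carrier H\<rbrakk> \<Longrightarrow>
     rescale H E d h \<phi> \<in> tuples E d \<rightarrow>\<^sub>E carrier H"
  unfolding rescale_def using finprod_nth_closed[of h E] by fastforce

lemma scale_one: "\<phi> \<in> tuples E d \<rightarrow>\<^sub>E carrier H \<Longrightarrow> scale H E d \<one> \<phi> = \<phi>"
  unfolding scale_def by (rule ext) (auto simp: PiE_iff extensional_def)

lemma scale_scale:
  "\<lbrakk>a \<in> carrier H; b \<in> carrier H; \<phi> \<in> tuples E d \<rightarrow>\<^sub>E carrier H\<rbrakk> \<Longrightarrow>
     scale H E d a (scale H E d b \<phi>) = scale H E d (a \<otimes> b) \<phi>"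
  unfolding scale_def by (rule ext) (auto simp: PiE_iff m_assoc)

lemma rescale_one: "\<phi> \<in> tuples E d \<rightarrow>\<^sub>E carrier H \<Longrightarrow> rescale H E d (\<lambda>_. \<one>) \<phi> = \<phi>"
  unfolding rescale_def by (rule ext) (auto simp: PiE_iff extensional_def)

lemma rescale_scale:
  assumes "h \<in> E \<rightarrow> Units H" "a \<in> carrier H" "\<phi> \<in> tuples E d \<rightarrow>\<^sub>E carrier H"
  shows "rescale H E d h (scale H E d a \<phi>) = scale H E d a (rescale H E d h \<phi>)"
proof
  fix xs
  show "rescale H E d h (scale H E d a \<phi>) xs = scale H E d a (rescale H E d h \<phi>) xs"
  proof (cases "xs \<in> tuples E d")
    case True
    then have "(\<Otimes>l\<in>{..<d}. h (xs ! l)) \<in> carrier H" using finprod_nth_closed assms by blast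
    then show ?thesis using True assms by (auto simp: rescale_def scale_def PiE_iff m_lcomm)
  qed (simp add: rescale_def scale_def)
qed

lemma rescale_rescale:
  assumes "h \<in> E \<rightarrow> Units H" "k \<in> E \<rightarrow> Units H" "\<phi> \<in> tuples E d \<rightarrow>\<^sub>E carrier H"
  shows "rescale H E d h (rescale H E d k \<phi>) = rescale H E d (\<lambda>e. h e \<otimes> k e) \<phi>"
proof
  fix xs
  show "rescale H E d h (rescale H E d k \<phi>) xs = rescale H E d (\<lambda>e. h e \<otimes> k e) \<phi> xs"
  proof (cases "xs \<in> tuples E d")
    case True
    have nth: "xs ! l \<in> E" if "l \<in> {..<d}" for l using that True by (auto simp: tuples_def)
    have h: "(\<lambda>l. h (xs ! l)) \<in> {..<d} \<rightarrow> carrier H" using nth assms(1) by blast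
    have k: "(\<lambda>l. k (xs ! l)) \<in> {..<d} \<rightarrow> carrier H" using nth assms(2) by blast
    have "\<phi> xs \<in> carrier H" using True assms(3) by blast
    then show ?thesis using True h k
      by (simp add: rescale_def finprod_multf[OF h k] finprod_closed[OF h] finprod_closed[OF k] m_assoc)
  qed (simp add: rescale_def)
qed

text \<open>The set \<open>P\<close> is not assumed closed under scaling: the relation only compares
  members of \<open>P\<close>, so it is enough that the scalars form a group. Symmetry comes from
  the inverse scalar and transitivity from the product.\<close>

lemma equiv_scale_rel:
  assumes P: "P \<subseteq> tuples E d \<rightarrow>\<^sub>E carrier H"
  shows "equiv P (scale_rel H E d P)"
proof (rule equivI)
  show "scale_rel H E d P \<subseteq> P \<times> P" by (auto simp: scale_rel_def)
  show "refl_on P (scale_rel H E d P)"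
    using P unfolding refl_on_def scale_rel_def hnonzero_eq_Units
    by (auto simp: scale_one subset_eq intro!: bexI[of _ \<one>])
  show "sym (scale_rel H E d P)"
    using P unfolding sym_def scale_rel_def hnonzero_eq_Units
    by (auto simp: scale_scale scale_one subset_eq intro!: bexI[of _ "inv _"])
  show "trans (scale_rel H E d P)"
    using P unfolding trans_def scale_rel_def hnonzero_eq_Units
    by (auto simp: scale_scale subset_eq)
qed

text \<open>
  Closure of \<open>P\<close> under scaling is what makes \<^const>\<open>rescale_rel\<close> independent of the choice of
  representatives, hence transitive.
\<close>

lemma rescale_rel_class_iff:
  assumes P: "P \<subseteq> tuples E d \<rightarrow>\<^sub>E carrier H"
    and closed: "\<And>a \<phi>. \<lbrakk>a \<in> Units H; \<phi> \<in> P\<rbrakk> \<Longrightarrow> scale H E d a \<phi> \<in> P"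
    and \<phi>: "\<phi> \<in> P" and \<psi>: "\<psi> \<in> P"
  shows "(scale_rel H E d P `` {\<phi>}, scale_rel H E d P `` {\<psi>}) \<in> rescale_rel H E d P \<longleftrightarrow>
    (\<exists>a\<in>Units H. \<exists>h\<in>E \<rightarrow> Units H. \<psi> = scale H E d a (rescale H E d h \<phi>))"
    (is "?L \<longleftrightarrow> ?R")
proof
  assume ?L
  then obtain \<phi>' h where 1: "(\<phi>, \<phi>') \<in> scale_rel H E d P" and h: "h \<in> E \<rightarrow> Units H"
    and 2: "(\<psi>, rescale H E d h \<phi>') \<in> scale_rel H E d P"
    unfolding rescale_rel_def hnonzero_eq_Units by blast
  obtain b where b: "b \<in> Units H" and \<phi>': "\<phi>' = scale H E d b \<phi>"
    using 1 unfolding scale_rel_def hnonzero_eq_Units by blast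
  obtain c where c: "c \<in> Units H" and eq: "rescale H E d h \<phi>' = scale H E d c \<psi>"
    using 2 unfolding scale_rel_def hnonzero_eq_Units by blast
  \<comment> \<open>The scalars \<open>b\<close> and \<open>c\<close> measure how far the
    representatives witnessing the relation are from \<open>\<phi>\<close> and
    \<open>\<psi>\<close>. Since scaling commutes with rescaling, they combine into the one scalar
    \<open>inv c \<otimes> b\<close>.\<close>
  have maps: "\<phi> \<in> tuples E d \<rightarrow>\<^sub>E carrier H" "\<psi> \<in> tuples E d \<rightarrow>\<^sub>E carrier H"
    using P \<phi> \<psi> by blast+
  note r = rescale_closed[OF h maps(1)]
  have "\<psi> = scale H E d (inv c) (rescale H E d h \<phi>')"
    unfolding eq using c by (simp add: scale_scale[OF _ _ maps(2)] scale_one[OF maps(2)])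
  also have "rescale H E d h \<phi>' = scale H E d b (rescale H E d h \<phi>)"
    unfolding \<phi>' using b by (simp add: rescale_scale[OF h _ maps(1)])
  finally have "\<psi> = scale H E d (inv c \<otimes> b) (rescale H E d h \<phi>)"
    using b c by (simp add: scale_scale[OF _ _ r])
  then show ?R using b c h by blast
next
  assume ?R
  then obtain a h where a: "a \<in> Units H" and h: "h \<in> E \<rightarrow> Units H"
    and eq: "\<psi> = scale H E d a (rescale H E d h \<phi>)" by blast
  have maps: "\<phi> \<in> tuples E d \<rightarrow>\<^sub>E carrier H" using P \<phi> by blast
  note r = rescale_closed[OF h maps]
  \<comment> \<open>\<open>scale_rel\<close> relates only members of \<open>P\<close>, so the
    rescaled function must first be shown to lie in \<open>P\<close>. It is a scalar multiple of
    \<open>\<psi>\<close>, and this is where closure under scaling enters.\<close>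
  have inv: "rescale H E d h \<phi> = scale H E d (inv a) \<psi>"
    unfolding eq using a by (simp add: scale_scale[OF _ _ r] scale_one[OF r])
  moreover have "scale H E d (inv a) \<psi> \<in> P" using closed a \<psi> by simp
  ultimately have "rescale H E d h \<phi> \<in> P" by simp
  then have "rescale H E d h \<phi> \<in> scale_rel H E d P `` {\<psi>}"
    using \<psi> Units_inv_Units[OF a] inv unfolding scale_rel_def hnonzero_eq_Units by blast
  moreover have "\<phi> \<in> scale_rel H E d P `` {\<phi>}"
    using equiv_class_self[OF equiv_scale_rel[OF P] \<phi>] .
  ultimately show ?L
    using h \<phi> \<psi> unfolding rescale_rel_def hmatroids_def hnonzero_eq_Units
    by (blast intro: quotientI)
qed

text \<open>On representatives the relation is the orbit relation of the units acting by
  \<open>scale\<close> together with the unit-valued functions on \<open>E\<close> acting by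
  \<open>rescale\<close>, and the group laws of these commuting actions give the three
  properties.\<close>

lemma equiv_rescale_rel:
  assumes P: "P \<subseteq> tuples E d \<rightarrow>\<^sub>E carrier H"
    and closed: "\<And>a \<phi>. \<lbrakk>a \<in> Units H; \<phi> \<in> P\<rbrakk> \<Longrightarrow> scale H E d a \<phi> \<in> P"
  shows "equiv (hmatroids H E d P) (rescale_rel H E d P)"
proof (rule equivI)
  let ?c = "\<lambda>\<phi>. scale_rel H E d P `` {\<phi>}"
  have iff: "(?c \<phi>, ?c \<psi>) \<in> rescale_rel H E d P \<longleftrightarrow>
      (\<exists>a\<in>Units H. \<exists>h\<in>E \<rightarrow> Units H. \<psi> = scale H E d a (rescale H E d h \<phi>))"
    if "\<phi> \<in> P" "\<psi> \<in> P" for \<phi> \<psi>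
    using rescale_rel_class_iff[OF P _ that] closed by blast
  show "rescale_rel H E d P \<subseteq> hmatroids H E d P \<times> hmatroids H E d P"
    by (auto simp: rescale_rel_def)
  have reps: "\<exists>\<phi>\<in>P. A = ?c \<phi>" if "A \<in> hmatroids H E d P" for A
    using that by (auto simp: hmatroids_def elim: quotientE)
  show "refl_on (hmatroids H E d P) (rescale_rel H E d P)"
  proof (rule refl_onI)
    fix A assume "A \<in> hmatroids H E d P"
    then obtain \<phi> where "\<phi> \<in> P" "A = ?c \<phi>" using reps by blast
    moreover have "\<phi> = scale H E d \<one> (rescale H E d (\<lambda>_. \<one>) \<phi>)"
      using P \<open>\<phi> \<in> P\<close> by (simp add: rescale_one scale_one subset_iff)
    moreover have "(\<lambda>_. \<one>) \<in> E \<rightarrow> Units H" by simp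
    ultimately show "(A, A) \<in> rescale_rel H E d P"
      using iff[of \<phi> \<phi>] Units_one_closed by blast
  qed
  show "sym (rescale_rel H E d P)"
  proof (rule symI)
    fix A B assume AB: "(A, B) \<in> rescale_rel H E d P"
    then have "A \<in> hmatroids H E d P" "B \<in> hmatroids H E d P" by (simp_all add: rescale_rel_def)
    then obtain \<phi> \<psi> where \<phi>: "\<phi> \<in> P" "A = ?c \<phi>" and \<psi>: "\<psi> \<in> P" "B = ?c \<psi>"
      by (metis reps)
    obtain a h where a: "a \<in> Units H" and h: "h \<in> E \<rightarrow> Units H"
      and eq: "\<psi> = scale H E d a (rescale H E d h \<phi>)" using AB unfolding \<phi>(2) \<psi>(2) iff[OF \<phi>(1) \<psi>(1)] by blast
    have h': "(\<lambda>e. inv (h e)) \<in> E \<rightarrow> Units H" using h by auto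
    have \<phi>': "\<phi> \<in> tuples E d \<rightarrow>\<^sub>E carrier H" using \<phi> P by blast
    note r = rescale_closed[OF h \<phi>']
    \<comment> \<open>The values of \<open>h\<close> are known to be units on \<open>E\<close> only,
      so the two weights need not agree as functions. They agree on the entries of every tuple,
      which is enough.\<close>
    have "rescale H E d (\<lambda>e. inv (h e) \<otimes> h e) \<phi> = rescale H E d (\<lambda>_. \<one>) \<phi>"
    proof -
      have "(\<Otimes>l\<in>{..<d}. inv (h (xs ! l)) \<otimes> h (xs ! l)) = (\<Otimes>l\<in>{..<d}. \<one>)"
        if "xs \<in> tuples E d" for xs
      proof (intro finprod_cong')
        fix l assume "l \<in> {..<d}"
        then have "xs ! l \<in> E" using that by (auto simp: tuples_def)
        then show "inv (h (xs ! l)) \<otimes> h (xs ! l) = \<one>" using h by (intro Units_l_inv) auto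
      qed auto
      then show ?thesis unfolding rescale_def by (intro restrict_ext) simp
    qed
    then have "rescale H E d (\<lambda>e. inv (h e)) (rescale H E d h \<phi>) = \<phi>"
      by (simp only: rescale_rescale[OF h' h \<phi>'] rescale_one[OF \<phi>'])
    then have "rescale H E d (\<lambda>e. inv (h e)) \<psi> = scale H E d a \<phi>"
      unfolding eq using a by (simp add: rescale_scale[OF h' _ r])
    then have "\<phi> = scale H E d (inv a) (rescale H E d (\<lambda>e. inv (h e)) \<psi>)"
      using a by (simp add: scale_scale[OF _ _ \<phi>'] scale_one[OF \<phi>'])
    then show "(B, A) \<in> rescale_rel H E d P"
      unfolding \<phi>(2) \<psi>(2) iff[OF \<psi>(1) \<phi>(1)]
      using Units_inv_Units[OF a] h' by blast
  qed
  show "trans (rescale_rel H E d P)"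
  proof (rule transI)
    fix A B C assume AB: "(A, B) \<in> rescale_rel H E d P" and BC: "(B, C) \<in> rescale_rel H E d P"
    then have "A \<in> hmatroids H E d P" "B \<in> hmatroids H E d P" "C \<in> hmatroids H E d P"
      by (simp_all add: rescale_rel_def)
    then obtain \<phi> \<psi> \<theta> where \<phi>: "\<phi> \<in> P" "A = ?c \<phi>" and \<psi>: "\<psi> \<in> P" "B = ?c \<psi>"
      and \<theta>: "\<theta> \<in> P" "C = ?c \<theta>"
      by (metis reps)
    obtain a h where a: "a \<in> Units H" and h: "h \<in> E \<rightarrow> Units H"
      and eq: "\<psi> = scale H E d a (rescale H E d h \<phi>)"
      using AB unfolding \<phi>(2) \<psi>(2) iff[OF \<phi>(1) \<psi>(1)] by blast
    obtain b k where b: "b \<in> Units H" and k: "k \<in> E \<rightarrow> Units H"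
      and eq': "\<theta> = scale H E d b (rescale H E d k \<psi>)" 
      using BC unfolding \<psi>(2) \<theta>(2) iff[OF \<psi>(1) \<theta>(1)] by blast
    have \<phi>': "\<phi> \<in> tuples E d \<rightarrow>\<^sub>E carrier H" using \<phi> P by blast
    have hk: "(\<lambda>e. k e \<otimes> h e) \<in> E \<rightarrow> Units H" using h k by auto
    have "rescale H E d k \<psi> = scale H E d a (rescale H E d (\<lambda>e. k e \<otimes> h e) \<phi>)"
      unfolding eq using a
      by (simp add: rescale_scale[OF k _ rescale_closed[OF h \<phi>']] rescale_rescale[OF k h \<phi>'])
    then have "\<theta> = scale H E d (b \<otimes> a) (rescale H E d (\<lambda>e. k e \<otimes> h e) \<phi>)"
      unfolding eq' using a b by (simp add: scale_scale[OF _ _ rescale_closed[OF hk \<phi>']])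
    then show "(A, C) \<in> rescale_rel H E d P"
      unfolding \<phi>(2) \<theta>(2) iff[OF \<phi>(1) \<theta>(1)] using Units_m_closed[OF b a] hk by blast
  qed
qed

section \<open>Scaling preserves weak and strong Grassmann--Pluecker functions\<close>

lemma nonzero_alternating_scale:
  assumes \<phi>: "nonzero_alternating H E d \<phi>" and a: "a \<in> Units H"
  shows "nonzero_alternating H E d (scale H E d a \<phi>)"
proof -
  have maps: "\<phi> \<in> tuples E d \<rightarrow>\<^sub>E carrier H" and alt: "alternating H E d \<phi>"
    using \<phi> by (auto simp: nonzero_alternating_def)
  have swap: "xs[i := xs ! j, j := xs ! i] \<in> tuples E d" if "xs \<in> tuples E d" "i < j" "j < d" for xs i j
    using that set_swap[of i xs j] by (simp add: tuples_def)
  have value_closed: "\<phi> xs \<in> carrier H" if "xs \<in> tuples E d" for xs using that maps by blast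
  have "alternating H E d (scale H E d a \<phi>)"
    using alt swap value_closed a unfolding alternating_def scale_def
    by (auto simp: hneg_mult mult_zero)
  moreover have "\<exists>xs\<in>tuples E d. scale H E d a \<phi> xs \<noteq> \<zero>"
  proof -
    obtain xs where xs: "xs \<in> tuples E d" "\<phi> xs \<noteq> \<zero>"
      using \<phi> by (auto simp: nonzero_alternating_def)
    then have "a \<otimes> \<phi> xs \<in> Units H"
      using a value_closed hnonzero_eq_Units by (auto simp: hnonzero_def)
    then show ?thesis
      using xs hnonzero_eq_Units by (auto simp: scale_def hnonzero_def)
  qed
  ultimately show ?thesis
    using scale_closed[OF _ maps] a unfolding nonzero_alternating_def by blast
qed

lemma gp_bases_scale:
  assumes \<phi>: "\<phi> \<in> tuples E d \<rightarrow>\<^sub>E carrier H" and a: "a \<in> Units H"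
  shows "gp_bases H E d (scale H E d a \<phi>) = gp_bases H E d \<phi>"
proof -
  have "scale H E d a \<phi> xs = \<zero> \<longleftrightarrow> \<phi> xs = \<zero>" if "xs \<in> tuples E d" for xs
  proof -
    have "\<phi> xs \<in> carrier H" using \<phi> that by blast
    then have "a \<otimes> \<phi> xs = a \<otimes> \<zero> \<longleftrightarrow> \<phi> xs = \<zero>" using a zero_closed by (intro Units_l_cancel)
    moreover have "a \<otimes> \<zero> = \<zero>" using a mult_zero by simp
    ultimately show ?thesis using that by (simp add: scale_def)
  qed
  then have "{xs \<in> tuples E d. scale H E d a \<phi> xs \<noteq> \<zero>} = {xs \<in> tuples E d. \<phi> xs \<noteq> \<zero>}" by blast
  then show ?thesis by (simp add: gp_bases_def)
qed

lemma gp_term_closed: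
  assumes \<phi>: "\<phi> \<in> tuples E d \<rightarrow>\<^sub>E carrier H"
    and "set xs \<subseteq> E" "length xs = d + 1" "set ys \<subseteq> E" "length ys + 1 = d" "k < length xs"
  shows "\<phi> (take k xs @ drop (Suc k) xs) \<in> carrier H" "\<phi> (xs ! k # ys) \<in> carrier H"
    and "take k xs @ drop (Suc k) xs \<in> tuples E d" "xs ! k # ys \<in> tuples E d"
proof -
  show *: "take k xs @ drop (Suc k) xs \<in> tuples E d" "xs ! k # ys \<in> tuples E d"
    using assms(2-) by (auto simp: tuples_def dest: in_set_takeD in_set_dropD)
  show "\<phi> (take k xs @ drop (Suc k) xs) \<in> carrier H" "\<phi> (xs ! k # ys) \<in> carrier H"
    using * \<phi> by auto
qed

text \<open>Every term of the relation contains two values of \<open>\<phi>\<close>, so the whole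
  hypersum is multiplied by \<open>a \<otimes> a\<close>, and zero stays in it.\<close>

lemma gp_relation_scale:
  fixes \<phi> :: "'c list \<Rightarrow> 'a"
  assumes \<phi>: "\<phi> \<in> tuples E d \<rightarrow>\<^sub>E carrier H" and a: "a \<in> Units H"
    and xs: "set xs \<subseteq> E" "length xs = d + 1" and ys: "set ys \<subseteq> E" "length ys + 1 = d"
    and gp: "gp_relation H \<phi> xs ys"
  shows "gp_relation H (scale H E d a \<phi>) xs ys"
proof -
  define t where "t \<psi> k = (hneg H \<one> [^] Suc k) \<otimes> \<psi> (take k xs @ drop (Suc k) xs) \<otimes> \<psi> (xs ! k # ys)"
    for \<psi> :: "'c list \<Rightarrow> 'a" and k
  note closed = gp_term_closed[OF \<phi> xs ys]
  have sgn: "hneg H \<one> [^] Suc k \<in> carrier H" for k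
    using hneg_closed by (intro nat_pow_closed) simp
  have "t (scale H E d a \<phi>) k = (a \<otimes> a) \<otimes> t \<phi> k" if "k < length xs" for k
    using closed[OF that] a sgn[of k]
    by (simp del: nat_pow_Suc add: t_def scale_def m_ac)
  then have eq: "map (t (scale H E d a \<phi>)) [0..<length xs] =
      map ((\<otimes>) (a \<otimes> a)) (map (t \<phi>) [0..<length xs])" by simp
  have "set (map (t \<phi>) [0..<length xs]) \<subseteq> carrier H"
    using closed sgn by (auto simp del: nat_pow_Suc simp: t_def)
  then have "hsum H (map (t (scale H E d a \<phi>)) [0..<length xs]) =
      (\<otimes>) (a \<otimes> a) ` hsum H (map (t \<phi>) [0..<length xs])"
    unfolding eq using a by (intro hsum_mult) auto
  moreover have "\<zero> \<in> hsum H (map (t \<phi>) [0..<length xs])"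
    using gp by (simp del: nat_pow_Suc add: gp_relation_def t_def[abs_def])
  moreover have "(a \<otimes> a) \<otimes> \<zero> = \<zero>" using a mult_zero by simp
  ultimately have "\<zero> \<in> hsum H (map (t (scale H E d a \<phi>)) [0..<length xs])" by (metis imageI)
  then show ?thesis by (simp del: nat_pow_Suc add: gp_relation_def t_def[abs_def])
qed

lemma weak_gp_functions_scale:
  assumes "\<phi> \<in> weak_gp_functions H E \<B>" "a \<in> Units H"
  shows "scale H E (matroid_rank \<B>) a \<phi> \<in> weak_gp_functions H E \<B>"
proof -
  have gp: "weak_gp H E (matroid_rank \<B>) \<phi>" and bases: "gp_bases H E (matroid_rank \<B>) \<phi> = \<B>"
    using assms by (auto simp: weak_gp_functions_def)
  then have \<phi>: "nonzero_alternating H E (matroid_rank \<B>) \<phi>" by (simp add: weak_gp_def)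
  note maps = nonzero_alternating_maps[OF \<phi>]
  show ?thesis
    using gp bases nonzero_alternating_scale[OF \<phi> assms(2)] gp_bases_scale[OF maps assms(2)]
      gp_relation_scale[OF maps assms(2)]
    unfolding weak_gp_functions_def weak_gp_def by simp
qed

lemma strong_gp_functions_scale:
  assumes "\<phi> \<in> strong_gp_functions H E \<B>" "a \<in> Units H"
  shows "scale H E (matroid_rank \<B>) a \<phi> \<in> strong_gp_functions H E \<B>"
proof -
  have gp: "strong_gp H E (matroid_rank \<B>) \<phi>" and bases: "gp_bases H E (matroid_rank \<B>) \<phi> = \<B>"
    using assms by (auto simp: strong_gp_functions_def)
  then have \<phi>: "nonzero_alternating H E (matroid_rank \<B>) \<phi>" by (simp add: strong_gp_def)
  note maps = nonzero_alternating_maps[OF \<phi>]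
  show ?thesis
    using gp bases nonzero_alternating_scale[OF \<phi> assms(2)] gp_bases_scale[OF maps assms(2)]
      gp_relation_scale[OF maps assms(2)]
    unfolding strong_gp_functions_def strong_gp_def by simp
qed

end


section \<open>Sub-hyperfields\<close>

lemma hinduced_simps [simp]:
  "carrier (hinduced H S) = S" "mult (hinduced H S) = mult H" "one (hinduced H S) = one H"
  "hzero (hinduced H S) = hzero H" "hadd (hinduced H S) x y = hadd H x y \<inter> S"
  by (simp_all add: hinduced_def)

lemma nat_pow_hinduced [simp]: "x [^]\<^bsub>hinduced H S\<^esub> (n::nat) = x [^]\<^bsub>H\<^esub> n"
  by (simp add: nat_pow_def)

lemma scale_hinduced [simp]: "scale (hinduced H S) = scale H"
  by (simp add: scale_def fun_eq_iff)

lemma gp_bases_hinduced [simp]: "gp_bases (hinduced H S) = gp_bases H"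
  by (simp add: gp_bases_def fun_eq_iff)

locale hyperfield_extension = hyperfield H + K: hyperfield "hinduced H S"
  for H (structure) and S +
  assumes subset_carrier: "S \<subseteq> carrier H"
begin

lemma one_in: "\<one> \<in> S" using K.one_closed by simp

lemma mult_in: "\<lbrakk>x \<in> S; y \<in> S\<rbrakk> \<Longrightarrow> x \<otimes> y \<in> S" using K.m_closed by simp

text \<open>In each of the two hyperfields the units are the nonzero elements, and both have the
  same zero. Hence a unit of \<open>H\<close> lying in \<open>S\<close> has its inverse in
  \<open>S\<close>.\<close>

lemma Units_hinduced: "Units (hinduced H S) = S \<inter> Units H"
  unfolding K.hnonzero_eq_Units[symmetric] hnonzero_eq_Units[symmetric]
  using subset_carrier by (auto simp: hnonzero_def)

lemma inv_in:
  assumes "u \<in> S" "u \<in> Units H"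
  shows "inv u \<in> S"
proof -
  have "u \<in> Units (hinduced H S)" using assms Units_hinduced by blast
  then obtain v where v: "v \<in> S" "v \<otimes> u = \<one>" by (auto simp: Units_def)
  then have "inv u = v" using assms inv_unique[of v u "inv u"] subset_carrier by auto
  then show ?thesis using v by simp
qed

text \<open>The induced hypersum is contained in the original one, so a negative in \<open>S\<close>
  is also a negative in \<open>H\<close>, where negatives are unique.\<close>

lemma hneg_hinduced:
  assumes "x \<in> S"
  shows "hneg (hinduced H S) x = hneg H x"
proof -
  have "hneg (hinduced H S) x \<in> S" "\<zero> \<in> x \<boxplus> hneg (hinduced H S) x"
    using K.hneg_props[of x] assms by auto
  then show ?thesis using hneg_unique assms subset_carrier by (metis subsetD)
qed

text \<open>\<open>finprod\<close> is defined through a fold that refers to the carrier, so sharing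
  multiplication and one does not make the two products equal by mere unfolding. Over an infinite
  index set both are one.\<close>

lemma finprod_hinduced:
  assumes "f \<in> A \<rightarrow> S"
  shows "finprod (hinduced H S) f A = finprod H f A"
  using assms
proof (induction A rule: infinite_finite_induct)
  case (insert x A)
  have S: "f \<in> A \<rightarrow> S" "f x \<in> S" using insert.prems by auto
  then have "f \<in> A \<rightarrow> carrier H" "f x \<in> carrier H" using subset_carrier by auto
  then show ?case using insert.IH insert.hyps S by simp
qed simp_all

lemma finprod_in: "f \<in> A \<rightarrow> S \<Longrightarrow> finprod H f A \<in> S"
  using K.finprod_closed[of f A] by (simp add: finprod_hinduced)

lemma rescale_hinduced:
  assumes "h \<in> E \<rightarrow> S"
  shows "rescale (hinduced H S) E d h \<phi> = rescale H E d h \<phi>"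
proof -
  have "(\<lambda>l. h (xs ! l)) \<in> {..<d} \<rightarrow> S" if "xs \<in> tuples E d" for xs
    using that assms by (force simp: tuples_def Pi_iff)
  then show ?thesis unfolding rescale_def by (intro restrict_ext) (simp add: finprod_hinduced)
qed

text \<open>Equality can fail, since the induced sums discard values outside \<open>S\<close> at
  every stage. The inclusion suffices because a Grassmann--Pluecker relation only asks that zero
  belong to the sum.\<close>

lemma hsum_hinduced_subset: "hsum (hinduced H S) ts \<subseteq> hsum H ts"
  by (induction ts) (auto simp: hadd_set_def)

lemma gp_relation_hinduced: "gp_relation (hinduced H S) \<phi> xs ys \<Longrightarrow> gp_relation H \<phi> xs ys"
  using hsum_hinduced_subset one_in by (auto simp: gp_relation_def hneg_hinduced)

lemma nonzero_alternating_hinduced: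
  assumes "nonzero_alternating (hinduced H S) E d \<phi>"
  shows "nonzero_alternating H E d \<phi>"
proof -
  have maps: "\<phi> \<in> tuples E d \<rightarrow>\<^sub>E S" using assms by (simp add: nonzero_alternating_def)
  then have "hneg (hinduced H S) (\<phi> xs) = hneg H (\<phi> xs)" if "xs \<in> tuples E d" for xs
    using that hneg_hinduced by blast
  then show ?thesis using assms subset_carrier maps
    by (auto simp: nonzero_alternating_def alternating_def PiE_iff)
qed

lemma weak_gp_functions_hinduced: "weak_gp_functions (hinduced H S) E \<B> \<subseteq> weak_gp_functions H E \<B>"
  by (auto simp: weak_gp_functions_def weak_gp_def
      intro: nonzero_alternating_hinduced gp_relation_hinduced)

lemma strong_gp_functions_hinduced:
  "strong_gp_functions (hinduced H S) E \<B> \<subseteq> strong_gp_functions H E \<B>"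
  by (auto simp: strong_gp_functions_def strong_gp_def
      intro: nonzero_alternating_hinduced gp_relation_hinduced)

section \<open>Descent of rescalings to the sub-hyperfield\<close>

lemma factor_in:
  assumes "a \<in> carrier H" "x \<in> S" "x \<noteq> \<zero>" "a \<otimes> x \<in> S"
  shows "a \<in> S"
proof -
  have u: "x \<in> Units H" using assms subset_carrier hnonzero_eq_Units by (auto simp: hnonzero_def)
  have "a = (a \<otimes> x) \<otimes> inv x" using assms(1) u by (simp add: m_assoc)
  then show ?thesis using assms mult_in inv_in u by metis
qed

text \<open>The given \<open>a\<close> and \<open>h\<close> may well lie outside \<open>S\<close>:
  multiplying \<open>h\<close> by a constant unit and dividing \<open>a\<close> by its
  \<open>d\<close>-th power does not change \<open>\<psi>\<close>. Hence a new pair has to be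
  constructed.\<close>

lemma rescaling_descends:
  assumes "matroid E \<B>"
    and \<phi>: "nonzero_alternating (hinduced H S) E d \<phi>" "gp_bases H E d \<phi> = \<B>"
    and \<psi>: "\<psi> \<in> tuples E d \<rightarrow>\<^sub>E S" "gp_bases H E d \<psi> = \<B>"
    and a: "a \<in> Units H" and h: "h \<in> E \<rightarrow> Units H"
    and eq: "\<psi> = scale H E d a (rescale H E d h \<phi>)"
  shows "\<exists>a'\<in>S \<inter> Units H. \<exists>h'\<in>E \<rightarrow> S \<inter> Units H. \<psi> = scale H E d a' (rescale H E d h' \<phi>)"
proof -
  interpret M: matroid E \<B> by fact
  have maps: "\<phi> \<in> tuples E d \<rightarrow>\<^sub>E S" and alt: "alternating (hinduced H S) E d \<phi>"
    using \<phi> by (auto simp: nonzero_alternating_def)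
  have \<phi>S: "\<phi> xs \<in> S" if "xs \<in> tuples E d" for xs using that maps by blast
  have distinct: "distinct xs" if "xs \<in> tuples E d" "\<phi> xs \<noteq> \<zero>" for xs
    using that alt by (auto simp: alternating_def)
  \<comment> \<open>An alternating function vanishes on tuples with repetitions, so where
    \<open>\<phi>\<close> is nonzero the product over positions is a product over the underlying
    basis.\<close>
  have nth_prod: "(\<Otimes>l\<in>{..<d}. g (xs ! l)) = finprod H g (set xs)"
    if "xs \<in> tuples E d" "\<phi> xs \<noteq> \<zero>" "g \<in> E \<rightarrow> carrier H" for g xs
  proof -
    have "set xs = (!) xs ` {..<d}" "inj_on ((!) xs) {..<d}"
      using that(1) distinct[OF that(1,2)]
      by (auto simp: tuples_def in_set_conv_nth inj_on_nth)
    moreover have "g \<in> (!) xs ` {..<d} \<rightarrow> carrier H"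
      using that(1,3) by (force simp: tuples_def Pi_iff)
    ultimately show ?thesis using finprod_reindex[of g "(!) xs" "{..<d}"] by simp
  qed
  have hc: "h \<in> E \<rightarrow> carrier H" using h by auto
  have \<psi>_eq: "\<psi> xs = a \<otimes> (finprod H h (set xs) \<otimes> \<phi> xs)"
    if "xs \<in> tuples E d" "\<phi> xs \<noteq> \<zero>" for xs
    using that by (simp add: eq scale_def rescale_def nth_prod[OF that hc])
  have hU: "finprod H h B \<in> Units H" if "B \<subseteq> E" for B
    using that h by (intro finprod_Units) auto
  \<comment> \<open>Order \<open>B\<close> as a tuple on which \<open>\<phi>\<close> is nonzero and
    divide the value of \<open>\<psi>\<close> by that of \<open>\<phi>\<close>; both lie in
    \<open>S\<close>.\<close>
  have basis: "a \<otimes> finprod H h B \<in> S" if B: "B \<in> \<B>" for B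
  proof -
    obtain xs where xs: "xs \<in> tuples E d" "\<phi> xs \<noteq> \<zero>" "B = set xs"
      using B \<phi>(2) by (auto simp: gp_bases_def)
    have "\<psi> xs \<in> S" using \<psi>(1) xs(1) by blast
    moreover have "finprod H h B \<in> carrier H" using hU B M.bases_subset by blast
    moreover have "\<phi> xs \<in> carrier H" using \<phi>S xs subset_carrier by blast
    ultimately have "a \<otimes> finprod H h B \<otimes> \<phi> xs \<in> S"
      using \<psi>_eq[OF xs(1,2)] a xs(3) by (simp add: m_assoc)
    then show ?thesis
      using factor_in[of "a \<otimes> finprod H h B" "\<phi> xs"] \<phi>S xs a \<open>finprod H h B \<in> carrier H\<close> by simp
  qed

  define coset where "coset x = {u \<otimes> x | u. u \<in> S \<inter> Units H}" for x
  \<comment> \<open>The choice is made from the coset as a set, so elements with equal cosets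
    receive the same representative.\<close>
  define rep where "rep C = (SOME y. y \<in> C)" for C :: "'a set"
  define k where "k e = rep (coset (h e))" for e
  have "k e \<in> coset (h e)" if "e \<in> E" for e
  proof -
    have "\<one> \<otimes> h e \<in> coset (h e)" using one_in by (auto simp: coset_def)
    then show ?thesis unfolding k_def rep_def by (rule someI)
  qed
  then have "\<exists>u \<in> S \<inter> Units H. k e = u \<otimes> h e" if "e \<in> E" for e
    using that by (fastforce simp: coset_def)
  then obtain u where u: "u e \<in> S \<inter> Units H" and ku: "k e = u e \<otimes> h e" if "e \<in> E" for e by metis
  have kU: "k \<in> E \<rightarrow> Units H"
  proof
    fix e assume "e \<in> E"
    then have "u e \<in> Units H" "h e \<in> Units H" using u h by auto
    then show "k e \<in> Units H" using ku \<open>e \<in> E\<close> by simp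
  qed
  define h' where "h' e = inv (u e)" for e
  have h': "h' \<in> E \<rightarrow> S \<inter> Units H" using u inv_in by (auto simp: h'_def)
  have hk: "h e = h' e \<otimes> k e" if "e \<in> E" for e
  proof -
    have "u e \<in> Units H" "h e \<in> carrier H" using u[OF that] hc that by auto
    then show ?thesis by (simp add: h'_def ku[OF that] m_assoc[symmetric])
  qed
  have exchange_eq: "k e = k f"
    if B: "B \<in> \<B>" "insert f (B - {e}) \<in> \<B>" and e: "e \<in> B" and f: "f \<in> E - B" for B e f
  proof -
    have BE: "B \<subseteq> E" and fin: "finite B" using B M.bases_subset M.finite_basis by auto
    \<comment> \<open>The common factor of the basis products for \<open>B\<close> and for the
      exchanged basis: these are \<open>p \<otimes> h e\<close> and \<open>p \<otimes> h f\<close>.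
      Both lie in \<open>S\<close>, so \<open>h e\<close> and \<open>h f\<close> differ by a unit of
      \<open>S\<close>.\<close>
    define p where "p = a \<otimes> finprod H h (B - {e})"
    have pU: "p \<in> Units H" and heU: "h e \<in> Units H" "h f \<in> Units H"
      using a hU[of "B - {e}"] BE e f h by (auto simp: p_def)
    have prod: "finprod H h (insert c (B - {e})) = h c \<otimes> finprod H h (B - {e})"
      if "c \<in> E" "c \<notin> B - {e}" for c
      using that fin BE hc by (intro finprod_insert) auto
    have "finprod H h (B - {e}) \<in> carrier H" using hU[of "B - {e}"] BE by auto
    moreover have "finprod H h (insert e (B - {e})) = h e \<otimes> finprod H h (B - {e})"
      "finprod H h (insert f (B - {e})) = h f \<otimes> finprod H h (B - {e})"
      using prod[of e] prod[of f] e f BE by blast+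
    ultimately have "p \<otimes> h e = a \<otimes> finprod H h B" "p \<otimes> h f = a \<otimes> finprod H h (insert f (B - {e}))"
      using a heU e by (simp_all add: p_def m_ac insert_absorb)
    then have v: "p \<otimes> h e \<in> S" and w: "p \<otimes> h f \<in> S" using basis B by simp_all
    \<comment> \<open>The hypotheses are symmetric in \<open>x\<close> and \<open>y\<close>, so one
      inclusion, used twice, gives equality of cosets.\<close>
    have sub: "coset (h x) \<subseteq> coset (h y)"
      if "p \<otimes> h x \<in> S" "p \<otimes> h y \<in> S" "h x \<in> Units H" "h y \<in> Units H" for x y
    proof
      fix z assume "z \<in> coset (h x)"
      then obtain t where t: "t \<in> S" "t \<in> Units H" "z = t \<otimes> h x" by (auto simp: coset_def)
      \<comment> \<open>With this \<open>w\<close>, the element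
        \<open>t \<otimes> (p \<otimes> h x) \<otimes> w\<close> is \<open>t \<otimes> h x\<close>
        divided by \<open>h y\<close>, written as a product of elements of \<open>S\<close>.\<close>
      define w where "w = inv (p \<otimes> h y)"
      have w: "w \<in> S" "w \<in> Units H" using that pU inv_in by (simp_all add: w_def)
      have "t \<otimes> (p \<otimes> h x) \<otimes> w \<in> S \<inter> Units H"
        using that t pU w mult_in by simp
      moreover have "t \<otimes> (p \<otimes> h x) \<otimes> w \<otimes> h y = z"
      proof -
        have "t \<otimes> (p \<otimes> h x) \<otimes> w \<otimes> h y = t \<otimes> h x \<otimes> (w \<otimes> (p \<otimes> h y))"
          using that(3,4) t(2) pU w(2) by (simp add: m_ac)
        also have "w \<otimes> (p \<otimes> h y) = \<one>" using that(4) pU by (simp add: w_def)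
        finally show ?thesis using that t by simp
      qed
      ultimately show "z \<in> coset (h y)" unfolding coset_def by blast
    qed
    have "coset (h e) = coset (h f)" using sub v w heU by blast
    then show ?thesis by (simp add: k_def)
  qed
  have kc: "k \<in> E \<rightarrow> carrier H" using kU by auto
  obtain B0 where B0: "B0 \<in> \<B>" using M.bases_nonempty by blast
  define a' where "a' = a \<otimes> finprod H k B0"
  have B0E: "B0 \<subseteq> E" using B0 M.bases_subset by blast
  have k0: "finprod H k B0 \<in> Units H" using kU B0E by (intro finprod_Units) auto
  then have a'U: "a' \<in> Units H" using a by (simp add: a'_def)
  have h'c: "h' \<in> E \<rightarrow> carrier H" "h' \<in> E \<rightarrow> Units H" "h' \<in> E \<rightarrow> S" using h' by auto
  have h'prod: "finprod H h' B \<in> Units H" if "B \<subseteq> E" for B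
    using that h' by (intro finprod_Units) auto
  \<comment> \<open>Factor \<open>h\<close> as \<open>h'\<close> times \<open>k\<close>. The product
    of \<open>k\<close> is the same over \<open>B\<close> as over \<open>B0\<close>, by
    \<open>exchange_eq\<close>, and so is exactly the factor contained in \<open>a'\<close>.\<close>
  have split: "a \<otimes> finprod H h B = a' \<otimes> finprod H h' B" if "B \<in> \<B>" for B
  proof -
    have BE: "B \<subseteq> E" using that M.bases_subset by blast
    have "finprod H h B = finprod H (\<lambda>e. h' e \<otimes> k e) B"
    proof (rule finprod_cong')
      show "(\<lambda>e. h' e \<otimes> k e) \<in> B \<rightarrow> carrier H"
        using BE kc h'c(1) by (intro funcsetI m_closed) blast+
    qed (use BE hk in auto)
    also have "\<dots> = finprod H h' B \<otimes> finprod H k B"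
      using BE kc h'c(1) by (intro finprod_multf) blast+
    also have "finprod H k B = finprod H k B0"
      by (rule M.finprod_bases_eq[OF comm_monoid_axioms kc _ that B0]) (rule exchange_eq)
    finally show ?thesis using a k0 h'prod[OF BE] by (simp add: a'_def m_ac)
  qed
  \<comment> \<open>For \<open>B0\<close>, the product of \<open>a'\<close> with a nonzero element
    of \<open>S\<close> is a basis product, hence in \<open>S\<close>; cancellation leaves
    \<open>a'\<close> in \<open>S\<close>.\<close>
  have a'S: "a' \<in> S"
  proof (rule factor_in)
    show "finprod H h' B0 \<in> S" using h' B0E by (intro finprod_in) auto
    show "finprod H h' B0 \<noteq> \<zero>"
      using h'prod[OF B0E] hnonzero_eq_Units by (auto simp: hnonzero_def)
    show "a' \<otimes> finprod H h' B0 \<in> S" using split[OF B0] basis[OF B0] by simp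
  qed (use a'U in auto)
  have "\<psi> = scale H E d a' (rescale H E d h' \<phi>)"
  proof
    fix xs
    \<comment> \<open>Outside the tuples both sides are undefined, and where \<open>\<phi>\<close>
      vanishes both are zero. In the remaining case \<open>set xs\<close> is a basis and
      \<open>split\<close> applies.\<close>
    consider "xs \<notin> tuples E d" | "xs \<in> tuples E d" "\<phi> xs = \<zero>" | "xs \<in> tuples E d" "\<phi> xs \<noteq> \<zero>" by blast
    then show "\<psi> xs = scale H E d a' (rescale H E d h' \<phi>) xs"
    proof cases
      case 1
      then show ?thesis by (simp add: eq scale_def)
    next
      case 2
      then show ?thesis
        using a a'U finprod_nth_closed[OF h] finprod_nth_closed[OF h'c(2)]
        by (simp add: eq scale_def rescale_def mult_zero)
    next
      case 3
      then have B: "set xs \<in> \<B>" using \<phi>(2) by (auto simp: gp_bases_def)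
      then have BE: "set xs \<subseteq> E" using M.bases_subset by blast
      have x: "\<phi> xs \<in> carrier H" using \<phi>S 3 subset_carrier by blast
      have "\<psi> xs = a \<otimes> finprod H h (set xs) \<otimes> \<phi> xs"
        using \<psi>_eq[OF 3] a hU[OF BE] x by (simp add: m_assoc)
      also have "\<dots> = a' \<otimes> (finprod H h' (set xs) \<otimes> \<phi> xs)"
        using split[OF B] a'U h'prod[OF BE] x by (simp add: m_assoc)
      finally show ?thesis using 3 by (simp add: scale_def rescale_def nth_prod[OF 3 h'c(1)])
    qed
  qed
  then show ?thesis using a'S a'U h' by blast
qed

text \<open>The weak and the strong case are treated together by abstracting the sets of
  Grassmann--Pluecker functions to \<open>P1\<close> and \<open>P2\<close>. The maps are fixed
  before the topologies, so the same \<open>i\<close> and \<open>j\<close> are continuous for every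
  admissible pair.\<close>

lemma embeddings:
  fixes E :: "'e set"
  assumes "matroid E \<B>"
    and P1: "\<And>\<phi>. \<phi> \<in> P1 \<Longrightarrow> nonzero_alternating (hinduced H S) E d \<phi> \<and> gp_bases H E d \<phi> = \<B>"
    and P2: "\<And>\<phi>. \<phi> \<in> P2 \<Longrightarrow> nonzero_alternating H E d \<phi>"
    and P12: "P1 \<subseteq> P2"
    and closed1: "\<And>a \<phi>. \<lbrakk>a \<in> Units (hinduced H S); \<phi> \<in> P1\<rbrakk> \<Longrightarrow> scale H E d a \<phi> \<in> P1"
    and closed2: "\<And>a \<phi>. \<lbrakk>a \<in> Units H; \<phi> \<in> P2\<rbrakk> \<Longrightarrow> scale H E d a \<phi> \<in> P2"
  shows "\<exists>i j.
    i \<in> hmatroids (hinduced H S) E d P1 \<rightarrow> hmatroids H E d P2 \<and>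
    inj_on i (hmatroids (hinduced H S) E d P1) \<and>
    j \<in> rescaling_classes (hinduced H S) E d P1 \<rightarrow> rescaling_classes H E d P2 \<and>
    inj_on j (rescaling_classes (hinduced H S) E d P1) \<and>
    (\<forall>T1 T2. topological_hyperfield (hinduced H S) T1 \<and> topological_hyperfield H T2 \<and>
        continuous_map T1 T2 (\<lambda>x. x) \<longrightarrow>
      continuous_map (hmatroids_topology (hinduced H S) T1 E d P1) (hmatroids_topology H T2 E d P2) i \<and>
      continuous_map (rescaling_classes_topology (hinduced H S) T1 E d P1)
        (rescaling_classes_topology H T2 E d P2) j)"
proof -
  let ?K = "hinduced H S"
  let ?r1 = "scale_rel ?K E d P1" and ?r2 = "scale_rel H E d P2"
  have fun1: "P1 \<subseteq> tuples E d \<rightarrow>\<^sub>E carrier ?K" and fun2: "P2 \<subseteq> tuples E d \<rightarrow>\<^sub>E carrier H"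
    using P1 P2 K.nonzero_alternating_maps nonzero_alternating_maps by blast+
  note eq1 = K.equiv_scale_rel[OF fun1] and eq2 = equiv_scale_rel[OF fun2]
  have rel_iff: "(\<phi>, \<psi>) \<in> ?r1 \<longleftrightarrow> (\<phi>, \<psi>) \<in> ?r2" if \<phi>: "\<phi> \<in> P1" and \<psi>: "\<psi> \<in> P1" for \<phi> \<psi>
  proof
    show "(\<phi>, \<psi>) \<in> ?r2" if "(\<phi>, \<psi>) \<in> ?r1"
      using that P12 subset_carrier by (auto simp: scale_rel_def hnonzero_def)
    assume "(\<phi>, \<psi>) \<in> ?r2"
    then obtain a where a: "a \<in> carrier H" "a \<noteq> \<zero>" and eq: "\<psi> = scale H E d a \<phi>"
      by (auto simp: scale_rel_def hnonzero_def)
    obtain xs where xs: "xs \<in> tuples E d" "\<phi> xs \<noteq> \<zero>"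
      using P1[OF \<phi>] by (auto simp: nonzero_alternating_def)
    \<comment> \<open>One nonzero value of \<open>\<phi>\<close> already determines the scalar as a
      quotient of two elements of \<open>S\<close>.\<close>
    have "a \<otimes> \<phi> xs = \<psi> xs" using xs by (simp add: eq scale_def)
    moreover have "\<phi> xs \<in> S" "\<psi> xs \<in> S" using fun1 \<phi> \<psi> xs(1) by auto
    ultimately have "a \<in> S" using factor_in a xs by metis
    then show "(\<phi>, \<psi>) \<in> ?r1" using a \<phi> \<psi> eq by (auto simp: scale_rel_def hnonzero_def)
  qed
  interpret I: relation_embedding P1 ?r1 P2 ?r2 "\<lambda>x. x"
    using eq1 eq2 P12 rel_iff by unfold_locales auto
  \<comment> \<open>Lifting the identity sends a class over \<open>S\<close> to the class over
    \<open>H\<close> that contains it.\<close>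
  let ?i = "quotient_lift ?r2 (\<lambda>x. x)"
  have i_class: "?i (?r1 `` {\<phi>}) = ?r2 `` {\<phi>}" if "\<phi> \<in> P1" for \<phi>
    using I.quotient_lift_class[OF that] .
  have i_maps: "?i \<in> hmatroids ?K E d P1 \<rightarrow> hmatroids H E d P2"
    using I.quotient_lift_maps_to by (simp add: hmatroids_def)
  let ?s1 = "rescale_rel ?K E d P1" and ?s2 = "rescale_rel H E d P2"
  have rescale_iff: "(A, B) \<in> ?s1 \<longleftrightarrow> (?i A, ?i B) \<in> ?s2"
    if "A \<in> hmatroids ?K E d P1" "B \<in> hmatroids ?K E d P1" for A B
  proof -
    obtain \<phi> \<psi> where \<phi>: "\<phi> \<in> P1" "A = ?r1 `` {\<phi>}" and \<psi>: "\<psi> \<in> P1" "B = ?r1 `` {\<psi>}"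
      using \<open>A \<in> _\<close> \<open>B \<in> _\<close> unfolding hmatroids_def by (metis quotientE)
    have "(A, B) \<in> ?s1 \<longleftrightarrow>
        (\<exists>a\<in>S \<inter> Units H. \<exists>h\<in>E \<rightarrow> S \<inter> Units H. \<psi> = scale H E d a (rescale ?K E d h \<phi>))"
      unfolding \<phi>(2) \<psi>(2)
      using K.rescale_rel_class_iff[OF fun1 _ \<phi>(1) \<psi>(1)] closed1 by (simp add: Units_hinduced)
    also have "\<dots> \<longleftrightarrow>
        (\<exists>a\<in>S \<inter> Units H. \<exists>h\<in>E \<rightarrow> S \<inter> Units H. \<psi> = scale H E d a (rescale H E d h \<phi>))"
    proof -
      have "rescale ?K E d h \<phi> = rescale H E d h \<phi>" if "h \<in> E \<rightarrow> S \<inter> Units H" for h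
        using that by (intro rescale_hinduced) auto
      then show ?thesis by auto
    qed
    \<comment> \<open>The step from \<open>H\<close> back to \<open>S\<close> is the descent of
      rescalings; it makes the map on rescaling classes injective.\<close>
    also have "\<dots> \<longleftrightarrow> (\<exists>a\<in>Units H. \<exists>h\<in>E \<rightarrow> Units H. \<psi> = scale H E d a (rescale H E d h \<phi>))"
    proof
      assume "\<exists>a\<in>Units H. \<exists>h\<in>E \<rightarrow> Units H. \<psi> = scale H E d a (rescale H E d h \<phi>)"
      moreover have "\<psi> \<in> tuples E d \<rightarrow>\<^sub>E S" using fun1 \<psi>(1) by auto
      ultimately show "\<exists>a\<in>S \<inter> Units H. \<exists>h\<in>E \<rightarrow> S \<inter> Units H. \<psi> = scale H E d a (rescale H E d h \<phi>)"
        using rescaling_descends[OF \<open>matroid E \<B>\<close>] P1 \<phi>(1) \<psi>(1) by metis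
    qed (fastforce simp: Pi_iff)
    also have "\<dots> \<longleftrightarrow> (?r2 `` {\<phi>}, ?r2 `` {\<psi>}) \<in> ?s2"
      using rescale_rel_class_iff[OF fun2 closed2] \<phi>(1) \<psi>(1) P12 by blast
    finally show ?thesis using \<phi> \<psi> i_class by simp
  qed
  interpret J: relation_embedding "hmatroids ?K E d P1" ?s1 "hmatroids H E d P2" ?s2 ?i
    using K.equiv_rescale_rel[OF fun1] equiv_rescale_rel[OF fun2] closed1 closed2 i_maps rescale_iff
    by unfold_locales auto
  let ?j = "quotient_lift ?s2 ?i"
  have "continuous_map (hmatroids_topology ?K T1 E d P1) (hmatroids_topology H T2 E d P2) ?i \<and>
      continuous_map (rescaling_classes_topology ?K T1 E d P1) (rescaling_classes_topology H T2 E d P2) ?j"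
    if T1: "topological_hyperfield ?K T1" and T2: "topological_hyperfield H T2"
      and incl: "continuous_map T1 T2 (\<lambda>x. x)" for T1 T2
  proof
    let ?X1 = "subtopology (product_topology (\<lambda>_. T1) (tuples E d)) P1"
    let ?X2 = "subtopology (product_topology (\<lambda>_. T2) (tuples E d)) P2"
    \<comment> \<open>The points of \<open>T1\<close> are exactly the elements of \<open>S\<close>,
      so every function in \<open>P1\<close> is a point of the product.\<close>
    have top1: "topspace ?X1 = P1"
      using T1 fun1 by (auto simp: topological_hyperfield_def)
    \<comment> \<open>Continuity into a product is checked on coordinates, each being a projection
      followed by the continuous inclusion of \<open>T1\<close> in \<open>T2\<close>.\<close>
    have "continuous_map ?X1 T2 (\<lambda>\<phi>. \<phi> xs)" if "xs \<in> tuples E d" for xs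
      using continuous_map_compose[OF
          continuous_map_from_subtopology[OF continuous_map_product_projection[OF that]] incl]
      by (simp add: o_def)
    then have "continuous_map ?X1 (product_topology (\<lambda>_. T2) (tuples E d)) (\<lambda>\<phi>. \<phi>)"
      using top1 fun1 unfolding continuous_map_componentwise by (auto simp: PiE_iff)
    then have "continuous_map ?X1 ?X2 (\<lambda>\<phi>. \<phi>)"
      using top1 P12 by (auto simp: continuous_map_in_subtopology)
    then show cont: "continuous_map (hmatroids_topology ?K T1 E d P1) (hmatroids_topology H T2 E d P2) ?i"
      unfolding hmatroids_topology_def by (rule I.continuous_map_quotient_lift[OF top1])
    have "topspace (hmatroids_topology ?K T1 E d P1) = hmatroids ?K E d P1"
      using top1 by (simp only: hmatroids_topology_def topspace_quotient_topology hmatroids_def)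
    then show "continuous_map (rescaling_classes_topology ?K T1 E d P1)
        (rescaling_classes_topology H T2 E d P2) ?j"
      using cont unfolding rescaling_classes_topology_def by (rule J.continuous_map_quotient_lift)
  qed
  moreover have "inj_on ?i (hmatroids ?K E d P1)"
    using I.inj_on_quotient_lift by (simp add: hmatroids_def)
  moreover have "?j \<in> rescaling_classes ?K E d P1 \<rightarrow> rescaling_classes H E d P2"
    "inj_on ?j (rescaling_classes ?K E d P1)"
    using J.quotient_lift_maps_to J.inj_on_quotient_lift by (simp_all add: rescaling_classes_def)
  ultimately show ?thesis using i_maps by blast
qed

end

section \<open>The weak and strong cases\<close>

theorem theorem4p8:
  fixes H2 :: "('a, 'm) hyperfield_scheme" and H1 :: "'a set"
    and E :: "'e set" and \<B> :: "'e set set"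
  assumes "matroid E \<B>"
    and "hyperfield H2"
    and "sub_hyperfield H1 H2"
  shows "(\<exists>i j.
      i \<in> weak_matroids (hinduced H2 H1) E \<B> \<rightarrow> weak_matroids H2 E \<B> \<and>
      inj_on i (weak_matroids (hinduced H2 H1) E \<B>) \<and>
      j \<in> weak_rescaling_classes (hinduced H2 H1) E \<B> \<rightarrow> weak_rescaling_classes H2 E \<B> \<and>
      inj_on j (weak_rescaling_classes (hinduced H2 H1) E \<B>) \<and>
      (\<forall>T1 T2. topological_hyperfield (hinduced H2 H1) T1 \<and> topological_hyperfield H2 T2 \<and>
               continuous_map T1 T2 (\<lambda>x. x) \<longrightarrow>
         continuous_map (weak_matroids_topology (hinduced H2 H1) T1 E \<B>)
           (weak_matroids_topology H2 T2 E \<B>) i \<and>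
         continuous_map (weak_rescaling_classes_topology (hinduced H2 H1) T1 E \<B>)
           (weak_rescaling_classes_topology H2 T2 E \<B>) j)) \<and>
    (\<exists>i j.
      i \<in> strong_matroids (hinduced H2 H1) E \<B> \<rightarrow> strong_matroids H2 E \<B> \<and>
      inj_on i (strong_matroids (hinduced H2 H1) E \<B>) \<and>
      j \<in> strong_rescaling_classes (hinduced H2 H1) E \<B> \<rightarrow> strong_rescaling_classes H2 E \<B> \<and>
      inj_on j (strong_rescaling_classes (hinduced H2 H1) E \<B>) \<and>
      (\<forall>T1 T2. topological_hyperfield (hinduced H2 H1) T1 \<and> topological_hyperfield H2 T2 \<and>
               continuous_map T1 T2 (\<lambda>x. x) \<longrightarrow>
         continuous_map (strong_matroids_topology (hinduced H2 H1) T1 E \<B>)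
           (strong_matroids_topology H2 T2 E \<B>) i \<and>
         continuous_map (strong_rescaling_classes_topology (hinduced H2 H1) T1 E \<B>)
           (strong_rescaling_classes_topology H2 T2 E \<B>) j))"
proof -
  interpret hyperfield_extension H2 H1
    using assms(2,3) by (simp add: hyperfield_extension_def hyperfield_extension_axioms_def
        sub_hyperfield_def)
  let ?d = "matroid_rank \<B>"
  \<comment> \<open>The hyperfield is left arbitrary here so that the fact applies both to
    \<open>H2\<close> and to the structure induced on \<open>H1\<close>.\<close>
  have weak: "nonzero_alternating H E ?d \<phi> \<and> gp_bases H E ?d \<phi> = \<B>"
    if "\<phi> \<in> weak_gp_functions H E \<B>" for H :: "('a, 'm) hyperfield_scheme" and \<phi>
    using that by (simp add: weak_gp_functions_def weak_gp_def)
  have strong: "nonzero_alternating H E ?d \<phi> \<and> gp_bases H E ?d \<phi> = \<B>"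
    if "\<phi> \<in> strong_gp_functions H E \<B>" for H :: "('a, 'm) hyperfield_scheme" and \<phi>
    using that by (simp add: strong_gp_functions_def strong_gp_def)
  show ?thesis
    unfolding weak_matroids_def strong_matroids_def weak_rescaling_classes_def
      strong_rescaling_classes_def weak_matroids_topology_def strong_matroids_topology_def
      weak_rescaling_classes_topology_def strong_rescaling_classes_topology_def
  proof (rule conjI; rule embeddings[OF assms(1)])
    show "weak_gp_functions (hinduced H2 H1) E \<B> \<subseteq> weak_gp_functions H2 E \<B>"
      by (rule weak_gp_functions_hinduced)
    show "strong_gp_functions (hinduced H2 H1) E \<B> \<subseteq> strong_gp_functions H2 E \<B>"
      by (rule strong_gp_functions_hinduced)
    show "scale H2 E ?d a \<phi> \<in> weak_gp_functions (hinduced H2 H1) E \<B>"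
      if "a \<in> Units (hinduced H2 H1)" "\<phi> \<in> weak_gp_functions (hinduced H2 H1) E \<B>" for a \<phi>
      using K.weak_gp_functions_scale[OF that(2,1)] by simp
    show "scale H2 E ?d a \<phi> \<in> strong_gp_functions (hinduced H2 H1) E \<B>"
      if "a \<in> Units (hinduced H2 H1)" "\<phi> \<in> strong_gp_functions (hinduced H2 H1) E \<B>" for a \<phi>
      using K.strong_gp_functions_scale[OF that(2,1)] by simp
    show "nonzero_alternating (hinduced H2 H1) E ?d \<phi> \<and> gp_bases H2 E ?d \<phi> = \<B>"
      if "\<phi> \<in> weak_gp_functions (hinduced H2 H1) E \<B>" for \<phi>
      using weak[OF that] by simp
    show "nonzero_alternating (hinduced H2 H1) E ?d \<phi> \<and> gp_bases H2 E ?d \<phi> = \<B>"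
      if "\<phi> \<in> strong_gp_functions (hinduced H2 H1) E \<B>" for \<phi>
      using strong[OF that] by simp
  qed (use weak strong weak_gp_functions_scale strong_gp_functions_scale in blast)+
qed

end
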